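(* Let $d\ge3$, let $T$ be the $d$-ary rooted tree and let $\mathcal M(d)=\langle m_1,\dots,m_d\rangle\subset\mathrm{Aut}(T)$ be Noce's group (a weakly branch non-contracting group). Then the germinal groupoid $\mathcal G(\partial T,\mathcal M(d),\Phi)$ associated to the action of $\mathcal M(d)$ on $\partial T$ has non-Hausdorff topology.
   Context: The $d$-ary rooted tree $T$ has as vertices the finite words over $\{0,1,\dots,d-1\}$ (root = empty word), each word $u$ joined by edges to the words $uk$, $0\le k\le d-1$. $\partial T$ is the set of infinite words with the product topology; $\mathrm{Aut}(T)$ acts on $\partial T$ by homeomorphisms. Notation: $g=(g_0,\dots,g_{d-1})\sigma$ with $g_i\in\mathrm{Aut}(T)$ and $\sigma$ a permutation of $\{0,\dots,d-1\}$ denotes the automorphism that first applies $\sigma$ to the first letter and then the $g_i$'s on the subtrees, i.e. $g(zw)=\sigma(z)\,g_{\sigma(z)}(w)$ for a letter $z$ and word $w$; trivial $\sigma$ is omitted, and $1$ is the identity. $\mathcal M(d)$ is generated by the recursively defined automorphisms $$m_1=(1,\dots,1,m_1)(0\,1\cdots d-1),\quad m_2=(1,\dots,1,m_2,1)(0\,1\cdots d-2),\ \dots,\ m_{d-1}=(1,m_{d-1},1,\dots,1)(0\,1),\quad m_d=(m_1,m_2,\dots,m_d),$$ i.e. for $1\le i\le d-1$, $m_i$ has the cycle $(0\,1\cdots d-i)$ as permutation and the entry $m_i$ in the coordinate indexed by $d-i$, all other entries being $1$. Germinal groupoid of an action of a group $\Gamma$ on a space $\mathfrak X$: for $g\in\Gamma$,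 $y\in\mathfrak X$, the germ $[g]_y$ is the class of $g$ under $g_1\sim_y g_2$ iff $g_1\cdot y=g_2\cdot y$ and $g_1,g_2$ agree on an open neighborhood of $y$. $\mathcal G(\mathfrak X,\Gamma,\Phi)=\{[g]_y\}$ with the sheaf topology, with basis the sets $\{[g]_y\mid y\in U\}$, $g\in\Gamma$, $U\subset\mathfrak X$ open. *)

theory Defs
  imports "HOL-Analysis.Analysis" "HOL-Algebra.Bij" "HOL-Algebra.Generated_Groups"
    "HOL-Algebra.Elementary_Groups"
begin

section \<open>The rooted tree, its automorphism group and its boundary\<close>

definition words :: "nat \<Rightarrow> nat list set" where
  "words d = lists {..<d}"

definition tree_adj :: "nat list \<Rightarrow> nat list \<Rightarrow> bool" where
  "tree_adj u v \<longleftrightarrow> (\<exists>k. v = u @ [k] \<or> u = v @ [k])"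

definition tree_automorphisms :: "nat \<Rightarrow> (nat list \<Rightarrow> nat list) set" where
  "tree_automorphisms d =
    {g \<in> Bij (words d). g [] = [] \<and>
       (\<forall>u\<in>words d. \<forall>v\<in>words d. tree_adj (g u) (g v) \<longleftrightarrow> tree_adj u v)}"

text \<open>As in \<^const>\<open>BijGroup\<close>, multiplication is composition of maps (right factor applied first).\<close>

definition Aut_tree :: "nat \<Rightarrow> (nat list \<Rightarrow> nat list) monoid" where
  "Aut_tree d = (BijGroup (words d)) \<lparr>carrier := tree_automorphisms d\<rparr>"

definition boundary :: "nat \<Rightarrow> (nat \<Rightarrow> nat) topology" where
  "boundary d = product_topology (\<lambda>_. discrete_topology {..<d}) UNIV"

text \<open>The image of an infinite word under a tree automorphism is the infinite word whose prefixes
  are the images of its prefixes, see \<open>boundary_act_prefix\<close> below.\<close>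

definition boundary_act :: "(nat list \<Rightarrow> nat list) \<Rightarrow> (nat \<Rightarrow> nat) \<Rightarrow> (nat \<Rightarrow> nat)" where
  "boundary_act g \<xi> = (\<lambda>n. g (map \<xi> [0..<Suc n]) ! n)"

section \<open>Noce's group\<close>

text \<open>The automorphism \<open>(g\<^sub>0, \<dots>, g\<^bsub>d-1\<^esub>)\<sigma>\<close>; the coordinates
  are indexed by the letter \<open>\<sigma> z\<close> reached by the permutation.\<close>

definition wreath ::
    "nat \<Rightarrow> (nat \<Rightarrow> nat list \<Rightarrow> nat list) \<Rightarrow> (nat \<Rightarrow> nat) \<Rightarrow> nat list \<Rightarrow> nat list" where
  "wreath d g \<sigma> = restrict (\<lambda>u. case u of [] \<Rightarrow> [] | z # w \<Rightarrow> \<sigma> z # g (\<sigma> z) w) (words d)"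

text \<open>The cycle \<open>(0 1 \<dots> d-i)\<close>.\<close>

definition noce_cycle :: "nat \<Rightarrow> nat \<Rightarrow> nat \<Rightarrow> nat" where
  "noce_cycle d i z = (if z \<le> d - i then Suc z mod Suc (d - i) else z)"

fun noce_map :: "nat \<Rightarrow> nat \<Rightarrow> nat list \<Rightarrow> nat list" where
  "noce_map d i [] = []"
| "noce_map d i (z # w) =
    (if i = d then z # noce_map d (Suc z) w
     else let s = noce_cycle d i z in s # (if s = d - i then noce_map d i w else w))"

text \<open>The generator \<open>m\<^sub>i\<close> for \<open>1 \<le> i \<le> d\<close>. Its defining wreath recursion is
  \<open>noce_gen_less\<close> and \<open>noce_gen_last\<close> below.\<close>

definition noce_gen :: "nat \<Rightarrow> nat \<Rightarrow> nat list \<Rightarrow> nat list" where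
  "noce_gen d i = restrict (noce_map d i) (words d)"

definition noce_group :: "nat \<Rightarrow> (nat list \<Rightarrow> nat list) monoid" where
  "noce_group d = subgroup_generated (Aut_tree d) (noce_gen d ` {1..d})"

section \<open>The germinal groupoid\<close>

definition germ_equiv ::
    "'x topology \<Rightarrow> ('g, 'm) monoid_scheme \<Rightarrow> ('g \<Rightarrow> 'x \<Rightarrow> 'x) \<Rightarrow> 'x \<Rightarrow> ('g \<times> 'g) set" where
  "germ_equiv X G \<Phi> y =
    {(g, h). g \<in> carrier G \<and> h \<in> carrier G \<and> \<Phi> g y = \<Phi> h y \<and>
       (\<exists>U. openin X U \<and> y \<in> U \<and> (\<forall>z\<in>U. \<Phi> g z = \<Phi> h z))}"

text \<open>The base point is recorded explicitly: one and the same subset of the group may be an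
  equivalence class for several base points.\<close>

definition germ ::
    "'x topology \<Rightarrow> ('g, 'm) monoid_scheme \<Rightarrow> ('g \<Rightarrow> 'x \<Rightarrow> 'x) \<Rightarrow> 'g \<Rightarrow> 'x \<Rightarrow> 'g set \<times> 'x" where
  "germ X G \<Phi> g y = (germ_equiv X G \<Phi> y `` {g}, y)"

definition germ_basis ::
    "'x topology \<Rightarrow> ('g, 'm) monoid_scheme \<Rightarrow> ('g \<Rightarrow> 'x \<Rightarrow> 'x) \<Rightarrow> ('g set \<times> 'x) set set" where
  "germ_basis X G \<Phi> = {germ X G \<Phi> g ` U |g U. g \<in> carrier G \<and> openin X U}"

text \<open>The set of all germs with the sheaf topology.\<close>

definition germinal_groupoid ::
    "'x topology \<Rightarrow> ('g, 'm) monoid_scheme \<Rightarrow> ('g \<Rightarrow> 'x \<Rightarrow> 'x) \<Rightarrow> ('g set \<times> 'x) topology" where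
  "germinal_groupoid X G \<Phi> = topology_generated_by (germ_basis X G \<Phi>)"

section \<open>Basic facts\<close>

lemma equiv_germ_equiv:
  assumes "y \<in> topspace X"
  shows "equiv (carrier G) (germ_equiv X G \<Phi> y)"
proof (rule equivI)
  show "germ_equiv X G \<Phi> y \<subseteq> carrier G \<times> carrier G"
    by (auto simp: germ_equiv_def)
  show "refl_on (carrier G) (germ_equiv X G \<Phi> y)"
    using assms openin_topspace by (force simp: refl_on_def germ_equiv_def)
  show "sym (germ_equiv X G \<Phi> y)"
    by (auto simp: sym_def germ_equiv_def)
  show "trans (germ_equiv X G \<Phi> y)"
  proof (rule transI)
    fix a b c
    assume "(a, b) \<in> germ_equiv X G \<Phi> y" "(b, c) \<in> germ_equiv X G \<Phi> y"
    then obtain U V where "openin X U" "y \<in> U" "\<forall>z\<in>U. \<Phi> a z = \<Phi> b z"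
        "openin X V" "y \<in> V" "\<forall>z\<in>V. \<Phi> b z = \<Phi> c z" "a \<in> carrier G" "c \<in> carrier G"
      by (auto simp: germ_equiv_def)
    then have "openin X (U \<inter> V) \<and> y \<in> U \<inter> V \<and> (\<forall>z\<in>U \<inter> V. \<Phi> a z = \<Phi> c z)"
      by auto
    then show "(a, c) \<in> germ_equiv X G \<Phi> y"
      using \<open>a \<in> carrier G\<close> \<open>c \<in> carrier G\<close> unfolding germ_equiv_def by blast
  qed
qed

lemma germ_eq_iff:
  assumes "y \<in> topspace X" "g \<in> carrier G" "h \<in> carrier G"
  shows "germ X G \<Phi> g y = germ X G \<Phi> h z \<longleftrightarrow> y = z \<and> (g, h) \<in> germ_equiv X G \<Phi> y"
  using eq_equiv_class_iff[OF equiv_germ_equiv[OF assms(1)] assms(2,3)]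
  by (auto simp: germ_def)

lemma topspace_germinal_groupoid:
  "topspace (germinal_groupoid X G \<Phi>) = {germ X G \<Phi> g y |g y. g \<in> carrier G \<and> y \<in> topspace X}"
proof -
  have "\<Union> (germ_basis X G \<Phi>) = {germ X G \<Phi> g y |g y. g \<in> carrier G \<and> y \<in> topspace X}"
    unfolding germ_basis_def using openin_subset openin_topspace by blast
  then show ?thesis
    by (simp add: germinal_groupoid_def)
qed

lemma germ_basis_Int:
  assumes "A \<in> germ_basis X G \<Phi>" "B \<in> germ_basis X G \<Phi>"
  shows "A \<inter> B \<in> germ_basis X G \<Phi>"
proof -
  obtain g U h V where g: "g \<in> carrier G" "openin X U" "A = germ X G \<Phi> g ` U"
    and h: "h \<in> carrier G" "openin X V" "B = germ X G \<Phi> h ` V"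
    using assms unfolding germ_basis_def by blast
  define W where "W = {y \<in> U \<inter> V. (g, h) \<in> germ_equiv X G \<Phi> y}"
  have "openin X W"
  proof (subst openin_subopen, intro ballI)
    fix y assume y: "y \<in> W"
    then obtain N where N: "openin X N" "y \<in> N" "\<forall>z\<in>N. \<Phi> g z = \<Phi> h z"
      by (auto simp: W_def germ_equiv_def)
    have "openin X (U \<inter> V \<inter> N)"
      using N g h by auto
    moreover have "U \<inter> V \<inter> N \<subseteq> W"
      using N g(1) h(1) unfolding W_def germ_equiv_def by blast
    ultimately show "\<exists>T. openin X T \<and> y \<in> T \<and> T \<subseteq> W"
      using y N by (intro exI[of _ "U \<inter> V \<inter> N"]) (auto simp: W_def)
  qed
  moreover have "A \<inter> B = germ X G \<Phi> g ` W"
  proof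
    show "A \<inter> B \<subseteq> germ X G \<Phi> g ` W"
    proof
      fix x assume "x \<in> A \<inter> B"
      then obtain y z where "y \<in> U" "z \<in> V" "x = germ X G \<Phi> g y" "x = germ X G \<Phi> h z"
        using g h by blast
      moreover from this have "y = z \<and> (g, h) \<in> germ_equiv X G \<Phi> y"
        using germ_eq_iff[of y X g G h \<Phi> z] g h openin_subset[OF g(2)] by auto
      ultimately show "x \<in> germ X G \<Phi> g ` W"
        by (auto simp: W_def)
    qed
    show "germ X G \<Phi> g ` W \<subseteq> A \<inter> B"
    proof
      fix x assume "x \<in> germ X G \<Phi> g ` W"
      then obtain y where y: "y \<in> U" "y \<in> V" "(g, h) \<in> germ_equiv X G \<Phi> y" "x = germ X G \<Phi> g y"
        by (auto simp: W_def)
      then have "x = germ X G \<Phi> h y"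
        using germ_eq_iff[of y X g G h \<Phi> y] g h openin_subset[OF g(2)] by auto
      then show "x \<in> A \<inter> B"
        unfolding g(3) h(3) using y(1,2,4) by blast
    qed
  qed
  ultimately show ?thesis
    using g(1) unfolding germ_basis_def by blast
qed

text \<open>The generating sets form a basis, not merely a subbasis.\<close>

lemma openin_germinal_groupoid:
  "openin (germinal_groupoid X G \<Phi>) = arbitrary union_of (\<lambda>S. S \<in> germ_basis X G \<Phi>)"
proof -
  have "istopology (arbitrary union_of (\<lambda>S. S \<in> germ_basis X G \<Phi>))"
    by (rule istopology_base) (rule germ_basis_Int)
  then have *: "openin (topology (arbitrary union_of (\<lambda>S. S \<in> germ_basis X G \<Phi>))) =
      arbitrary union_of (\<lambda>S. S \<in> germ_basis X G \<Phi>)"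
    by (simp add: topology_inverse')
  have "germinal_groupoid X G \<Phi> = topology (arbitrary union_of (\<lambda>S. S \<in> germ_basis X G \<Phi>))"
    unfolding topology_eq
  proof (intro allI iffI)
    fix S assume "openin (germinal_groupoid X G \<Phi>) S"
    then have "generate_topology_on (germ_basis X G \<Phi>) S"
      by (simp add: germinal_groupoid_def openin_topology_generated_by_iff)
    then show "openin (topology (arbitrary union_of (\<lambda>S. S \<in> germ_basis X G \<Phi>))) S"
    proof induction
      case (Basis s)
      then show ?case by (simp add: * arbitrary_union_of_inc)
    qed (use openin_Union in auto)
  next
    fix S assume "openin (topology (arbitrary union_of (\<lambda>S. S \<in> germ_basis X G \<Phi>))) S"
    then have "(arbitrary union_of (\<lambda>S. S \<in> germ_basis X G \<Phi>)) S"
      by (simp only: *)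
    then obtain \<U> where "\<U> \<subseteq> Collect (\<lambda>S. S \<in> germ_basis X G \<Phi>)" "S = \<Union>\<U>"
      unfolding union_of_def by metis
    then show "openin (germinal_groupoid X G \<Phi>) S"
      unfolding germinal_groupoid_def
      by (metis mem_Collect_eq openin_Union subsetD topology_generated_by_Basis)
  qed
  then show ?thesis by (simp add: *)
qed

lemma words_simps [simp]:
  "[] \<in> words d" "z # w \<in> words d \<longleftrightarrow> z < d \<and> w \<in> words d"
  "u @ v \<in> words d \<longleftrightarrow> u \<in> words d \<and> v \<in> words d"
  by (auto simp: words_def)

lemma subgroup_tree_automorphisms: "subgroup (tree_automorphisms d) (BijGroup (words d))"
proof (rule group.subgroupI[OF group_BijGroup])
  show "tree_automorphisms d \<subseteq> carrier (BijGroup (words d))"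
    by (auto simp: tree_automorphisms_def BijGroup_def)
  have "(\<lambda>x\<in>words d. x) \<in> tree_automorphisms d"
    by (auto simp: tree_automorphisms_def id_Bij)
  then show "tree_automorphisms d \<noteq> {}" by blast
  fix a assume a: "a \<in> tree_automorphisms d"
  have aB: "a \<in> Bij (words d)" and a0: "a [] = []"
    and aadj: "\<And>u v. u \<in> words d \<Longrightarrow> v \<in> words d \<Longrightarrow> tree_adj (a u) (a v) \<longleftrightarrow> tree_adj u v"
    using a by (auto simp: tree_automorphisms_def)
  have bij: "bij_betw a (words d) (words d)"
    using aB by (auto simp: Bij_def)
  have im: "a ` words d = words d" using bij by (simp add: bij_betw_def)
  have inj: "inj_on a (words d)" using bij by (simp add: bij_betw_def)
  define b where "b = (\<lambda>x\<in>words d. inv_into (words d) a x)"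
  have b_in: "b u \<in> words d" and ab: "a (b u) = u" if "u \<in> words d" for u
    using that im by (auto simp: b_def inv_into_into f_inv_into_f)
  have "b [] = []"
    using inv_into_f_f[OF inj, of "[]"] a0 by (simp add: b_def)
  moreover have "b \<in> Bij (words d)"
    unfolding b_def by (rule restrict_inv_into_Bij[OF aB])
  moreover have "tree_adj (b u) (b v) \<longleftrightarrow> tree_adj u v" if "u \<in> words d" "v \<in> words d" for u v
    using aadj[OF b_in b_in, of u v] that by (simp add: ab)
  ultimately show "inv\<^bsub>BijGroup (words d)\<^esub> a \<in> tree_automorphisms d"
    by (simp add: inv_BijGroup[OF aB] b_def[symmetric] tree_automorphisms_def)
  fix c assume c: "c \<in> tree_automorphisms d"
  then have cB: "c \<in> Bij (words d)"
    by (auto simp: tree_automorphisms_def)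
  have "compose (words d) a c \<in> Bij (words d)"
    using aB cB by (rule compose_Bij)
  moreover have "c u \<in> words d" if "u \<in> words d" for u
    using that cB by (auto simp: Bij_def bij_betw_def)
  ultimately show "a \<otimes>\<^bsub>BijGroup (words d)\<^esub> c \<in> tree_automorphisms d"
    using a c aB cB by (auto simp: tree_automorphisms_def BijGroup_def compose_def)
qed

lemma group_Aut_tree: "group (Aut_tree d)"
  unfolding Aut_tree_def
  by (rule subgroup.subgroup_is_group[OF subgroup_tree_automorphisms group_BijGroup])

lemma tree_automorphism_child:
  assumes g: "g \<in> tree_automorphisms d" and u: "u @ [k] \<in> words d"
  shows "\<exists>k'<d. g (u @ [k]) = g u @ [k']"
proof -
  have in_w: "g u \<in> words d" if "u \<in> words d" for u
    using that g by (auto simp: tree_automorphisms_def Bij_def bij_betw_def)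
  have adj: "tree_adj (g u) (g (u @ [k]))" if "u @ [k] \<in> words d" for u k
  proof -
    have "tree_adj u (u @ [k])" by (auto simp: tree_adj_def)
    then show ?thesis using that g by (auto simp: tree_automorphisms_def)
  qed
  show ?thesis
    using u
  proof (induction u arbitrary: k rule: rev_induct)
    case Nil
    then have "tree_adj [] (g [k])" "g [k] \<in> words d" "g [] = []"
      using adj[of "[]" k] in_w[of "[k]"] g by (auto simp: tree_automorphisms_def)
    then show ?case by (auto simp: tree_adj_def)
  next
    case (snoc j u)
    have j: "u @ [j] \<in> words d" using snoc.prems by simp
    obtain j' where j': "g (u @ [j]) = g u @ [j']" using snoc.IH[OF j] by blast
    consider k' where "g ((u @ [j]) @ [k]) = g (u @ [j]) @ [k']"
      | k' where "g (u @ [j]) = g ((u @ [j]) @ [k]) @ [k']"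
      using adj[OF snoc.prems] by (auto simp: tree_adj_def)
    then show ?case
    proof cases
      case 1
      then show ?thesis using in_w[OF snoc.prems] by auto
    next
      case 2
      then have "g ((u @ [j]) @ [k]) = g u" using j' by simp
      moreover have "inj_on g (words d)"
        using g by (auto simp: tree_automorphisms_def Bij_def bij_betw_def)
      ultimately have "(u @ [j]) @ [k] = u"
        using snoc.prems by (auto dest!: inj_onD)
      then show ?thesis by simp
    qed
  qed
qed

lemma topspace_boundary: "topspace (boundary d) = {\<xi>. \<forall>n. \<xi> n < d}"
  by (auto simp: boundary_def)

lemma prefix_in_words: "\<xi> \<in> topspace (boundary d) \<Longrightarrow> map \<xi> [0..<n] \<in> words d"
  by (auto simp: topspace_boundary words_def)

lemma boundary_act_prefix:
  assumes g: "g \<in> tree_automorphisms d" and \<xi>: "\<xi> \<in> topspace (boundary d)"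
  shows "map (boundary_act g \<xi>) [0..<n] = g (map \<xi> [0..<n])"
proof (induction n)
  case 0
  then show ?case using g by (simp add: tree_automorphisms_def)
next
  case (Suc n)
  obtain k where k: "g (map \<xi> [0..<Suc n]) = g (map \<xi> [0..<n]) @ [k]"
    using tree_automorphism_child[OF g, of "map \<xi> [0..<n]" "\<xi> n"] prefix_in_words[OF \<xi>, of "Suc n"]
    by auto
  have "length (g (map \<xi> [0..<n])) = n"
    using Suc.IH by (metis length_map length_upt diff_zero)
  then have "boundary_act g \<xi> n = k"
    using k by (simp add: boundary_act_def nth_append del: upt_Suc)
  then show ?case using Suc.IH k by simp
qed

lemma boundary_act_in_boundary:
  assumes g: "g \<in> tree_automorphisms d" and \<xi>: "\<xi> \<in> topspace (boundary d)"
  shows "boundary_act g \<xi> \<in> topspace (boundary d)"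
proof -
  have "boundary_act g \<xi> n < d" for n
  proof -
    have "g (map \<xi> [0..<Suc n]) \<in> words d"
      using g prefix_in_words[OF \<xi>, of "Suc n"]
      by (auto simp: tree_automorphisms_def Bij_def bij_betw_def simp del: upt_Suc)
    then show ?thesis
      unfolding boundary_act_prefix[OF g \<xi>, symmetric] by simp
  qed
  then show ?thesis by (simp add: topspace_boundary)
qed

lemma boundary_act_mult:
  assumes "g \<in> carrier (Aut_tree d)" "h \<in> carrier (Aut_tree d)" "\<xi> \<in> topspace (boundary d)"
  shows "boundary_act (g \<otimes>\<^bsub>Aut_tree d\<^esub> h) \<xi> = boundary_act g (boundary_act h \<xi>)"
proof
  fix n
  have h: "h \<in> tree_automorphisms d" "g \<in> Bij (words d)" "h \<in> Bij (words d)"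
    using assms by (auto simp: Aut_tree_def tree_automorphisms_def)
  show "boundary_act (g \<otimes>\<^bsub>Aut_tree d\<^esub> h) \<xi> n = boundary_act g (boundary_act h \<xi>) n"
    using h prefix_in_words[OF assms(3), of "Suc n"]
    unfolding boundary_act_def[of g] boundary_act_prefix[OF h(1) assms(3)]
    by (simp add: boundary_act_def Aut_tree_def BijGroup_def compose_def del: upt_Suc)
qed

lemma boundary_act_one:
  assumes "\<xi> \<in> topspace (boundary d)"
  shows "boundary_act \<one>\<^bsub>Aut_tree d\<^esub> \<xi> = \<xi>"
proof
  fix n show "boundary_act \<one>\<^bsub>Aut_tree d\<^esub> \<xi> n = \<xi> n"
    using prefix_in_words[OF assms, of "Suc n"]
    by (simp add: boundary_act_def Aut_tree_def BijGroup_def nth_append del: upt_Suc)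
qed

lemma noce_cycle_less: "1 \<le> i \<Longrightarrow> z < d \<Longrightarrow> noce_cycle d i z < d"
  by (auto simp: noce_cycle_def intro: order.strict_trans1[OF mod_less_eq_dividend]
      order.strict_trans2[OF mod_less_divisor])

lemma inj_noce_cycle: "inj (noce_cycle d i)"
proof (rule injI)
  fix x y assume eq: "noce_cycle d i x = noce_cycle d i y"
  have mod: "Suc z mod Suc (d - i) = (if z = d - i then 0 else Suc z)" if "z \<le> d - i" for z
    using that by auto
  have le: "Suc z mod Suc (d - i) \<le> d - i" for z
    by (metis less_Suc_eq_le mod_less_divisor zero_less_Suc)
  show "x = y"
    using eq le[of x] le[of y] by (auto simp: noce_cycle_def mod split: if_splits)
qed

lemma length_noce_map [simp]: "length (noce_map d i w) = length w"
  by (induction d i w rule: noce_map.induct) (auto simp: Let_def)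

lemma noce_map_in_words: "1 \<le> i \<Longrightarrow> w \<in> words d \<Longrightarrow> noce_map d i w \<in> words d"
proof (induction w arbitrary: i)
  case (Cons z w)
  then show ?case by (auto simp: Let_def noce_cycle_less)
qed simp

lemma inj_noce_map: "noce_map d i v = noce_map d i w \<Longrightarrow> v = w"
proof (induction v arbitrary: w i)
  case Nil
  then show ?case by (metis length_0_conv length_noce_map)
next
  case (Cons z v)
  then obtain z' w' where w: "w = z' # w'"
    by (metis length_Suc_conv length_noce_map)
  show ?case
    using Cons.prems Cons.IH injD[OF inj_noce_cycle, of d i z z']
    by (auto simp: w Let_def split: if_splits)
qed

lemma noce_map_snoc: "\<exists>k'. noce_map d i (w @ [k]) = noce_map d i w @ [k']"
  by (induction w arbitrary: i) (auto simp: Let_def)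

lemma bij_noce_map: 
  assumes "1 \<le> i"
  shows "bij_betw (noce_map d i) (words d) (words d)"
proof -
  have "noce_map d i ` words d = words d"
  proof
    show "noce_map d i ` words d \<subseteq> words d"
      using noce_map_in_words[OF assms] by blast
    show "words d \<subseteq> noce_map d i ` words d"
    proof
      fix w assume w: "w \<in> words d"
      define L where "L = {u. set u \<subseteq> {..<d} \<and> length u = length w}"
      have L: "L = {u \<in> words d. length u = length w}"
        by (auto simp: L_def words_def)
      have "finite L" unfolding L_def by (rule finite_lists_length_eq) simp
      moreover have "noce_map d i ` L \<subseteq> L"
        using noce_map_in_words[OF assms] by (auto simp: L)
      moreover have "inj_on (noce_map d i) L"
        using inj_noce_map by (auto intro: inj_onI)
      ultimately have "noce_map d i ` L = L"
        by (rule endo_inj_surj)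
      moreover have "w \<in> L" using w by (simp add: L)
      ultimately show "w \<in> noce_map d i ` words d" unfolding L by blast
    qed
  qed
  then show ?thesis
    using inj_noce_map by (auto simp: bij_betw_def intro: inj_onI)
qed

lemma noce_gen_in_Aut_tree:
  assumes "1 \<le> i"
  shows "noce_gen d i \<in> carrier (Aut_tree d)"
proof -
  have "noce_gen d i \<in> Bij (words d)"
    using bij_noce_map[OF assms, of d] by (simp add: noce_gen_def Bij_def bij_betw_restrict_eq)
  moreover have "tree_adj (noce_map d i u) (noce_map d i v) \<longleftrightarrow> tree_adj u v" for u v
  proof
    show "tree_adj (noce_map d i u) (noce_map d i v)" if "tree_adj u v"
      using that noce_map_snoc unfolding tree_adj_def by blast
    have *: "\<exists>k. v = u @ [k]" if eq: "noce_map d i v = noce_map d i u @ [k]" for u v k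
    proof -
      obtain v' j where v: "v = v' @ [j]"
        using eq by (cases v rule: rev_cases) auto
      obtain j' where "noce_map d i v = noce_map d i v' @ [j']"
        using noce_map_snoc unfolding v by blast
      then have "noce_map d i v' = noce_map d i u"
        using eq by simp
      then show ?thesis using v inj_noce_map by blast
    qed
    show "tree_adj u v" if "tree_adj (noce_map d i u) (noce_map d i v)"
      using that * unfolding tree_adj_def by blast
  qed
  ultimately show ?thesis
    by (auto simp: Aut_tree_def tree_automorphisms_def noce_gen_def)
qed

lemma carrier_noce_group:
  "carrier (noce_group d) = generate (Aut_tree d) (noce_gen d ` {1..d})"
proof -
  have "carrier (Aut_tree d) \<inter> noce_gen d ` {1..d} = noce_gen d ` {1..d}"
    using noce_gen_in_Aut_tree by auto
  then show ?thesis
    by (simp add: noce_group_def carrier_subgroup_generated)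
qed

lemma noce_gen_less:
  assumes "1 \<le> i" "i < d"
  shows "noce_gen d i =
    wreath d (\<lambda>j. if j = d - i then noce_gen d i else \<one>\<^bsub>Aut_tree d\<^esub>) (noce_cycle d i)"
  using assms
  by (auto simp: noce_gen_def wreath_def Aut_tree_def BijGroup_def fun_eq_iff restrict_def Let_def
      split: list.split)

lemma noce_gen_last: "noce_gen d d = wreath d (\<lambda>j. noce_gen d (Suc j)) id"
  by (auto simp: noce_gen_def wreath_def fun_eq_iff restrict_def split: list.split)

end

theory Submission
  imports Defs
begin

text \<open>
  Two germs at the same point \<open>y\<close> cannot be separated as soon as they are distinct but
  the two group elements have equal germs at points arbitrarily close to \<open>y\<close>: every group
  element \<open>g\<close> gives a continuous map \<open>z \<mapsto> [g]\<^sub>z\<close> into the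
  groupoid (\<open>continuous_map_germ\<close>), so neighbourhoods of the two germs at \<open>y\<close> both contain
  the common germ at some nearby point (\<open>not_Hausdorff_germinal_groupoid\<close>).

  For Noce's group this happens for \<open>m\<^sub>d\<close> and the identity at the point
  \<open>y = (d-1)(d-1)(d-1)\<dots>\<close>. Since \<open>m\<^sub>d = (m\<^sub>1, \<dots>, m\<^sub>d)\<close>,
  a word \<open>(d-1)\<^sup>n z w\<close> with \<open>z < d - 1\<close> is sent to
  \<open>(d-1)\<^sup>n z m\<^bsub>z+1\<^esub>(w)\<close>. For \<open>z = d - 2\<close> the automorphism
  \<open>m\<^bsub>d-1\<^esub>\<close> acts nontrivially only on words starting with 0 or 1; it is the identity below the letter 2, which
  exists because \<open>d \<ge> 3\<close>; so \<open>m\<^sub>d\<close> is the identity on the cylinder of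
  \<open>(d-1)\<^sup>n (d-2) 2\<close>. For \<open>z = 0\<close> the automorphism \<open>m\<^sub>1\<close> moves every
  first letter; so \<open>m\<^sub>d\<close> moves points in every neighbourhood of \<open>y\<close>.
\<close>

lemma continuous_map_germ:
  assumes g: "g \<in> carrier G"
  shows "continuous_map X (germinal_groupoid X G \<Phi>) (germ X G \<Phi> g)"
  unfolding germinal_groupoid_def
proof (rule continuous_on_generated_topo)
  fix B assume "B \<in> germ_basis X G \<Phi>"
  then obtain h V where h: "h \<in> carrier G" "openin X V" and B: "B = germ X G \<Phi> h ` V"
    unfolding germ_basis_def by blast
  show "openin X (germ X G \<Phi> g -` B \<inter> topspace X)"
  proof (subst openin_subopen, intro ballI)
    fix y assume "y \<in> germ X G \<Phi> g -` B \<inter> topspace X"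
    then obtain v where y: "y \<in> topspace X" and v: "v \<in> V" "germ X G \<Phi> g y = germ X G \<Phi> h v"
      unfolding B by blast
    have "y = v" and "(g, h) \<in> germ_equiv X G \<Phi> y"
      using v germ_eq_iff[OF y g h(1), of \<Phi> v] by auto
    then obtain N where N: "openin X N" "y \<in> N" "\<forall>z\<in>N. \<Phi> g z = \<Phi> h z"
      by (auto simp: germ_equiv_def)
    have "N \<inter> V \<subseteq> germ X G \<Phi> g -` B \<inter> topspace X"
    proof
      fix z assume z: "z \<in> N \<inter> V"
      then have zX: "z \<in> topspace X"
        using openin_subset[OF h(2)] by blast
      have "(g, h) \<in> germ_equiv X G \<Phi> z"
        using N z g h(1) unfolding germ_equiv_def by blast
      then have "germ X G \<Phi> g z = germ X G \<Phi> h z"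
        by (simp add: germ_eq_iff[OF zX g h(1)])
      then show "z \<in> germ X G \<Phi> g -` B \<inter> topspace X"
        using z zX by (auto simp: B)
    qed
    then show "\<exists>T. openin X T \<and> y \<in> T \<and> T \<subseteq> germ X G \<Phi> g -` B \<inter> topspace X"
      using N h(2) v(1) \<open>y = v\<close> by (intro exI[of _ "N \<inter> V"]) auto
  qed
next
  show "germ X G \<Phi> g ` topspace X \<subseteq> \<Union> (germ_basis X G \<Phi>)"
    using g openin_topspace unfolding germ_basis_def by blast
qed

lemma not_Hausdorff_germinal_groupoid:
  assumes g: "g \<in> carrier G" and h: "h \<in> carrier G" and y: "y \<in> topspace X"
    and distinct: "(g, h) \<notin> germ_equiv X G \<Phi> y"
    and close: "\<And>U. openin X U \<Longrightarrow> y \<in> U \<Longrightarrow> \<exists>z\<in>U. (g, h) \<in> germ_equiv X G \<Phi> z"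
  shows "\<not> Hausdorff_space (germinal_groupoid X G \<Phi>)"
proof
  let ?T = "germinal_groupoid X G \<Phi>"
  assume "Hausdorff_space ?T"
  moreover have "germ X G \<Phi> g y \<in> topspace ?T" "germ X G \<Phi> h y \<in> topspace ?T"
    using g h y by (auto simp: topspace_germinal_groupoid)
  moreover have "germ X G \<Phi> g y \<noteq> germ X G \<Phi> h y"
    using distinct by (simp add: germ_eq_iff[OF y g h])
  ultimately obtain A B where AB: "openin ?T A" "openin ?T B" "disjnt A B"
      "germ X G \<Phi> g y \<in> A" "germ X G \<Phi> h y \<in> B"
    unfolding Hausdorff_space_def by metis
  define U where "U = {z \<in> topspace X. germ X G \<Phi> g z \<in> A} \<inter> {z \<in> topspace X. germ X G \<Phi> h z \<in> B}"
  have "openin X U"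
    unfolding U_def
    using continuous_map_germ[OF g] continuous_map_germ[OF h] AB(1,2)
    by (intro openin_Int openin_continuous_map_preimage)
  moreover have "y \<in> U"
    using y AB by (simp add: U_def)
  ultimately obtain z where z: "z \<in> U" "(g, h) \<in> germ_equiv X G \<Phi> z"
    using close by blast
  then have "germ X G \<Phi> g z = germ X G \<Phi> h z"
    using germ_eq_iff[of z X g G h \<Phi> z] g h by (auto simp: U_def)
  then have "germ X G \<Phi> g z \<in> A \<inter> B"
    using z(1) by (simp add: U_def)
  then show False
    using AB(3) by (auto simp: disjnt_def)
qed

lemma openin_boundary_cylinder:
  "openin (boundary d) {\<xi> \<in> topspace (boundary d). map \<xi> [0..<length u] = u}"
proof -
  let ?V = "\<lambda>i. if i < length u then {u ! i} \<inter> {..<d} else {..<d}"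
  have pre: "map \<xi> [0..<length u] = u \<longleftrightarrow> (\<forall>i<length u. \<xi> i = u ! i)" for \<xi> :: "nat \<Rightarrow> nat"
    by (subst list_eq_iff_nth_eq) simp
  have mem: "\<xi> i \<in> ?V i \<longleftrightarrow> \<xi> i < d \<and> (i < length u \<longrightarrow> \<xi> i = u ! i)" for \<xi> :: "nat \<Rightarrow> nat" and i
    by (cases "i < length u") auto
  have "{\<xi> \<in> topspace (boundary d). map \<xi> [0..<length u] = u} = Pi\<^sub>E UNIV ?V"
    unfolding topspace_boundary pre PiE_UNIV_domain Pi_def mem by blast
  moreover have "openin (product_topology (\<lambda>_. discrete_topology {..<d}) UNIV) (Pi\<^sub>E UNIV ?V)"
  proof (rule product_topology_basis)
    show "finite {i. ?V i \<noteq> topspace (discrete_topology {..<d})}"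
      by (rule finite_subset[OF _ finite_lessThan[of "length u"]]) (auto split: if_splits)
  qed simp
  ultimately show ?thesis
    by (simp only: boundary_def)
qed

lemma boundary_open_contains_cylinder:
  assumes "openin (boundary d) U" "\<eta> \<in> U"
  obtains n where "\<And>\<xi>. \<xi> \<in> topspace (boundary d) \<Longrightarrow> (\<And>k. k < n \<Longrightarrow> \<xi> k = \<eta> k) \<Longrightarrow> \<xi> \<in> U"
proof -
  obtain V where V: "finite {i. V i \<noteq> {..<d}}" "\<eta> \<in> Pi\<^sub>E UNIV V" "Pi\<^sub>E UNIV V \<subseteq> U"
    using assms unfolding boundary_def openin_product_topology_alt by force
  obtain n where n: "\<And>i. V i \<noteq> {..<d} \<Longrightarrow> i < n"
    using V(1) unfolding finite_nat_set_iff_bounded by auto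
  have "\<xi> \<in> U" if "\<xi> \<in> topspace (boundary d)" "\<And>k. k < n \<Longrightarrow> \<xi> k = \<eta> k" for \<xi>
  proof -
    have "\<xi> i \<in> V i" for i
    proof (cases "i < n")
      case True
      then show ?thesis using that(2) V(2) by (auto simp: PiE_iff)
    next
      case False
      then have "V i = {..<d}" using n by blast
      then show ?thesis using that(1) by (simp add: topspace_boundary)
    qed
    then show ?thesis using V(3) by (auto simp: PiE_iff)
  qed
  then show thesis using that by blast
qed

lemma noce_map_last_replicate:
  "1 \<le> d \<Longrightarrow> noce_map d d (replicate n (d - 1) @ w) = replicate n (d - 1) @ noce_map d d w"
  by (induction n) auto

lemma noce_map_last_trivial:
  assumes "3 \<le> d"
  shows "noce_map d d ((replicate n (d - 1) @ [d - 2, 2]) @ w) = (replicate n (d - 1) @ [d - 2, 2]) @ w"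
proof -
  have "Suc (d - 2) = d - 1" "d - 1 \<noteq> d" "d - (d - 1) = 1"
    using assms by auto
  then have "noce_map d d ((d - 2) # 2 # w) = (d - 2) # 2 # w"
    by (simp add: noce_cycle_def Let_def)
  moreover have "1 \<le> d"
    using assms by simp
  ultimately show ?thesis
    by (simp only: noce_map_last_replicate append_assoc append.simps)
qed

lemma noce_map_last_moves:
  assumes "3 \<le> d"
  shows "noce_map d d (replicate n (d - 1) @ [0, 0]) = replicate n (d - 1) @ [0, 1]"
proof -
  have "noce_map d d [0, 0] = [0, 1]"
    using assms by (simp add: noce_cycle_def Let_def)
  moreover have "1 \<le> d"
    using assms by simp
  ultimately show ?thesis
    by (simp only: noce_map_last_replicate append_assoc append.simps)
qed

text \<open>An automorphism that is the identity on the subtree below \<open>u\<close> fixes the cylinder of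
  \<open>u\<close> pointwise.\<close>

lemma boundary_act_fixes_cylinder:
  assumes g: "g \<in> tree_automorphisms d"
    and fix_u: "\<And>w. u @ w \<in> words d \<Longrightarrow> g (u @ w) = u @ w"
    and \<xi>: "\<xi> \<in> topspace (boundary d)" "map \<xi> [0..<length u] = u"
  shows "boundary_act g \<xi> = \<xi>"
proof
  fix m
  \<comment> \<open>a prefix long enough to contain both \<open>u\<close> and the letter at position \<open>m\<close>\<close>
  define N where "N = length u + Suc m"
  have "map \<xi> [0..<N] = u @ map \<xi> [length u..<N]"
    using \<xi>(2) upt_add_eq_append[of 0 "length u" "Suc m"] by (simp add: N_def)
  then have "g (map \<xi> [0..<N]) = map \<xi> [0..<N]"
    using fix_u prefix_in_words[OF \<xi>(1), of N] by metis
  then have "map (boundary_act g \<xi>) [0..<N] = map \<xi> [0..<N]"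
    by (simp add: boundary_act_prefix[OF g \<xi>(1)])
  then have "\<forall>k\<in>set [0..<N]. boundary_act g \<xi> k = \<xi> k"
    by (simp only: map_eq_conv)
  then show "boundary_act g \<xi> m = \<xi> m"
    by (auto simp: N_def simp del: upt_Suc)
qed

theorem theorem1p6:
  fixes d :: nat
  assumes "d \<ge> 3"
  shows "\<not> Hausdorff_space (germinal_groupoid (boundary d) (noce_group d) boundary_act)"
proof (rule not_Hausdorff_germinal_groupoid)
  let ?g = "noce_gen d d" and ?e = "\<one>\<^bsub>Aut_tree d\<^esub>" and ?y = "\<lambda>_::nat. d - 1"
  show gG: "?g \<in> carrier (noce_group d)"
    using assms by (auto simp: carrier_noce_group intro!: generate.incl)
  show eG: "?e \<in> carrier (noce_group d)"
    by (simp add: carrier_noce_group generate.one)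
  have g: "?g \<in> tree_automorphisms d"
    using noce_gen_in_Aut_tree[of d d] assms by (simp add: Aut_tree_def)
  show "?y \<in> topspace (boundary d)"
    using assms by (simp add: topspace_boundary)
  show "(?g, ?e) \<notin> germ_equiv (boundary d) (noce_group d) boundary_act ?y"
  proof
    assume "(?g, ?e) \<in> germ_equiv (boundary d) (noce_group d) boundary_act ?y"
    then obtain U where U: "openin (boundary d) U" "?y \<in> U"
        "\<forall>z\<in>U. boundary_act ?g z = boundary_act ?e z"
      by (auto simp: germ_equiv_def)
    obtain n where n: "\<And>\<xi>. \<xi> \<in> topspace (boundary d) \<Longrightarrow> (\<And>k. k < n \<Longrightarrow> \<xi> k = d - 1) \<Longrightarrow> \<xi> \<in> U"
      using boundary_open_contains_cylinder[OF U(1,2)] by blast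
    \<comment> \<open>the point \<open>(d-1)\<^sup>n 0 0 0 \<dots>\<close>, whose letter at position \<open>n + 1\<close> is moved to 1\<close>
    define \<xi> where "\<xi> k = (if k < n then d - 1 else 0)" for k
    have \<xi>: "\<xi> \<in> topspace (boundary d)"
      using assms by (simp add: topspace_boundary \<xi>_def)
    have "boundary_act ?g \<xi> = \<xi>"
      using U(3) n[OF \<xi>] boundary_act_one[OF \<xi>] by (simp add: \<xi>_def)
    then have "?g (map \<xi> [0..<n + 2]) = map \<xi> [0..<n + 2]"
      using boundary_act_prefix[OF g \<xi>, of "n + 2"] by simp
    moreover have "map \<xi> [0..<n + 2] = replicate n (d - 1) @ [0, 0]"
      by (rule nth_equalityI) (auto simp: \<xi>_def nth_append nth_Cons' simp del: upt_Suc)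
    ultimately show False
      using prefix_in_words[OF \<xi>, of "n + 2"] noce_map_last_moves[OF assms, of n]
      by (simp add: noce_gen_def)
  qed
  show "\<exists>z\<in>U. (?g, ?e) \<in> germ_equiv (boundary d) (noce_group d) boundary_act z"
    if U: "openin (boundary d) U" "?y \<in> U" for U
  proof -
    obtain n where n: "\<And>\<xi>. \<xi> \<in> topspace (boundary d) \<Longrightarrow> (\<And>k. k < n \<Longrightarrow> \<xi> k = d - 1) \<Longrightarrow> \<xi> \<in> U"
      using boundary_open_contains_cylinder[OF U] by blast
    define u where "u = replicate n (d - 1) @ [d - 2, 2]"
    define C where "C = {\<xi> \<in> topspace (boundary d). map \<xi> [0..<length u] = u}"
    have fixed: "boundary_act ?g \<xi> = boundary_act ?e \<xi>" if "\<xi> \<in> C" for \<xi>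
    proof -
      have "boundary_act ?g \<xi> = \<xi>"
        using that noce_map_last_trivial[OF assms, of n, folded u_def]
        by (intro boundary_act_fixes_cylinder[OF g, of u]) (auto simp: C_def noce_gen_def)
      then show ?thesis
        using that by (simp add: C_def boundary_act_one)
    qed
    \<comment> \<open>any extension of \<open>u\<close> to an infinite word would do\<close>
    define z where "z k = (if k < length u then u ! k else 0)" for k
    have "z \<in> topspace (boundary d)"
      using assms by (auto simp: topspace_boundary z_def u_def nth_append nth_Cons')
    moreover have "map z [0..<length u] = u"
      by (rule nth_equalityI) (auto simp: z_def)
    ultimately have "z \<in> C" by (simp add: C_def)
    then have "(?g, ?e) \<in> germ_equiv (boundary d) (noce_group d) boundary_act z"
      using gG eG fixed openin_boundary_cylinder[of d u]
      unfolding germ_equiv_def C_def[symmetric] by blast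
    moreover have "z \<in> U"
      using \<open>z \<in> topspace (boundary d)\<close> by (rule n) (simp add: z_def u_def nth_append)
    ultimately show ?thesis by blast
  qed
qed

end
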